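(* Fix $s$ and $\beta>0$, and denote by $\mathcal{C}(N)=\mathcal{C}_{s,\beta}(N)$ the Cheeger constant of the random graph $G_{s,\beta}(N)$ (the long-range percolation graph on the cycle $\mathbb{Z}/N\mathbb{Z}$). (A) If $1<s<2$, then there is a constant $\alpha=\alpha(s)$ such that $$\lim_{N\to\infty}\mathbf{P}\left(\mathcal{C}(N)>N^{-\alpha}\right)=0.$$ (B) If $s=2$, then for every $\epsilon>0$ there is $C$ such that $$\limsup_{N\to\infty}\mathbf{P}\left(\mathcal{C}(N)>\frac{C\log N}{N}\right)<\epsilon.$$
   Context: For a positive integer $N$ and $s,\beta>0$, the random graph $G_{s,\beta}(N)$ is defined as follows. Its vertices are the elements of the cycle $\mathbb{Z}/N\mathbb{Z}$, represented by $0,1,\dots,N-1$. Put $\rho(x,y)=\min(|x-y|,\,N-|x-y|)$. If $\rho(x,y)=1$, then $x$ and $y$ are joined by an edge (with certainty). If $x\ne y$ and $\rho(x,y)\neq 1$, then $x$ and $y$ are joined by an edge with probability $1-\exp(-\beta\rho(x,y)^{-s})$. The different edges are all independent of each other. For a finite graph $G$ with $|G|$ vertices and a set of vertices $A$, let $\partial A$ be the set of edges with one endpoint in $A$ and the other in the complement $A^c$. The Cheeger constant of $G$ is $$\mathcal{C}(G)=\inf_A\frac{|\partial A|}{|A|},$$ where the infimum is over all nonempty sets of vertices $A$ with $|A|\le |G|/2$. *)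

theory Defs
  imports "HOL-Probability.Probability"
begin

text \<open>A finite graph is given by its vertex set \<open>V\<close> and its set \<open>E\<close> of edges, each edge being a
  two-element set of vertices.\<close>

definition edge_boundary :: "'a set \<Rightarrow> 'a set set \<Rightarrow> 'a set \<Rightarrow> 'a set set" where
  "edge_boundary V E A = {e \<in> E. \<exists>x\<in>A. \<exists>y\<in>V - A. e = {x, y}}"

text \<open>If \<open>V\<close> has at most one vertex, there is no admissible \<open>A\<close> and the value is an unspecified real
  number.\<close>

definition cheeger_constant :: "'a set \<Rightarrow> 'a set set \<Rightarrow> real" where
  "cheeger_constant V E =
     (INF A\<in>{A. A \<subseteq> V \<and> A \<noteq> {} \<and> real (card A) \<le> real (card V) / 2}.
        real (card (edge_boundary V E A)) / real (card A))"

definition cycle_dist :: "nat \<Rightarrow> nat \<Rightarrow> nat \<Rightarrow> int" where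
  "cycle_dist N x y = min \<bar>int x - int y\<bar> (int N - \<bar>int x - int y\<bar>)"

definition edge_prob :: "real \<Rightarrow> real \<Rightarrow> nat \<Rightarrow> nat \<Rightarrow> nat \<Rightarrow> real" where
  "edge_prob s \<beta> N x y =
     (if cycle_dist N x y = 1 then 1
      else 1 - exp (- \<beta> * real_of_int (cycle_dist N x y) powr (- s)))"

text \<open>Each unordered pair of distinct vertices is represented by the pair \<open>(x, y)\<close> with \<open>x < y\<close>.\<close>

definition vertex_pairs :: "nat \<Rightarrow> (nat \<times> nat) set" where
  "vertex_pairs N = {(x, y). x < y \<and> y < N}"

text \<open>The law of the edge set of the random graph on the vertex set \<open>{..<N}\<close>: one independent
  Bernoulli variable for each pair of distinct vertices.\<close>

definition long_range_percolation :: "real \<Rightarrow> real \<Rightarrow> nat \<Rightarrow> nat set set pmf" where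
  "long_range_percolation s \<beta> N =
     map_pmf (\<lambda>\<omega>. {{x, y} | x y. (x, y) \<in> vertex_pairs N \<and> \<omega> (x, y)})
       (Pi_pmf (vertex_pairs N) False (\<lambda>(x, y). bernoulli_pmf (edge_prob s \<beta> N x y)))"

end

theory Submission
  imports Defs "HOL-Real_Asymp.Real_Asymp"
begin

text \<open>Cut the cycle into the two arcs \<open>{..<m}\<close> and \<open>{m..<N}\<close> with \<open>m = N div 2\<close>. There are at
  most \<open>2 k\<close> pairs at distance \<open>k\<close> across the cut, each joined with probability \<open>O(k powr - s)\<close>, so
  the expected number of edges across is of order at most the sum of \<open>k powr (1 - s)\<close> over \<open>k \<le> N\<close>,
  which is \<open>O(N powr (2 - s) * (1 + ln N))\<close> for \<open>s \<le> 2\<close>. Dividing by \<open>m\<close> and applying Markov's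
  inequality gives both claims.\<close>

text \<open>Telescoping: for \<open>b\<close> \<ge> 1 one has \<open>b + 1\<close> \<le>
  \<open>2 * b\<close>, so the inverse square of \<open>b\<close> is at most
  \<open>2 / (b * (b + 1))\<close>, a difference of consecutive values of
  \<open>2 / b\<close>.\<close>

lemma sum_inverse_squares_le:
  fixes a :: real
  assumes "a \<ge> 1"
  shows "(\<Sum>j<n. 1 / (a + real j)\<^sup>2) \<le> 2 / a"
proof -
  have "1 / (a + real j)\<^sup>2 \<le> 2 / (a + real j) - 2 / (a + real (Suc j))" for j
  proof -
    define b where "b = a + real j"
    have b: "b \<ge> 1" using assms by (simp add: b_def)
    have "1 / b\<^sup>2 \<le> 2 / (b * (b + 1))"
      using b by (simp add: divide_simps power2_eq_square)
    also have "\<dots> = 2 / b - 2 / (b + 1)"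
      using b by (simp add: divide_simps)
    finally show ?thesis by (simp add: b_def add_ac)
  qed
  hence "(\<Sum>j<n. 1 / (a + real j)\<^sup>2) \<le> (\<Sum>j<n. 2 / (a + real j) - 2 / (a + real (Suc j)))"
    by (intro sum_mono)
  also have "\<dots> = 2 / a - 2 / (a + real n)"
    by (subst sum_lessThan_telescope') simp
  also have "\<dots> \<le> 2 / a" using assms by simp
  finally show ?thesis .
qed

text \<open>Induction on \<open>n\<close>: the inequality ln x \<le> x - 1 at x = n / (n + 1) says
  that the new summand is at most \<open>ln (n + 1) - ln n\<close>.\<close>

lemma sum_inverse_le_ln:
  assumes "n \<ge> 1"
  shows "(\<Sum>i<n. 1 / (real i + 1)) \<le> 1 + ln (real n)"
  using assms
proof (induction n rule: dec_induct)
  case base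
  show ?case by simp
next
  case (step n)
  have "ln (real n / real (Suc n)) \<le> real n / real (Suc n) - 1"
    using step.hyps by (intro ln_le_minus_one) auto
  moreover have "ln (real n / real (Suc n)) = ln (real n) - ln (real (Suc n))"
    using step.hyps by (simp add: ln_div)
  moreover have "real n / real (Suc n) - 1 = - 1 / (real n + 1)"
    by (simp add: divide_simps)
  ultimately show ?case using step.IH by simp
qed

text \<open>Every k = i + j + 1 in the sum is at most \<open>N\<close>, and k powr (2 - s) is
  nondecreasing in k because s \<le> 2. Extracting this factor leaves inverse squares: the sum over
  \<open>j\<close> is at most 2 / (i + 1), and the harmonic sum over \<open>i\<close> gives the
  logarithm. One estimate thus serves s < 2 and s = 2; in the first case a power of \<open>N\<close>
  later absorbs the logarithm.\<close>

lemma double_sum_powr_le: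
  assumes "s \<le> 2" "n \<ge> 1" "n + k \<le> N"
  shows "(\<Sum>i<n. \<Sum>j<k. real (i + j + 1) powr (- s))
           \<le> 2 * real N powr (2 - s) * (1 + ln (real N))"
proof -
  have "real (i + j + 1) powr (- s) \<le> real N powr (2 - s) * (1 / (real i + 1 + real j)\<^sup>2)"
    if "i < n" "j < k" for i j
  proof -
    have "real (i + j + 1) powr (- s) = real (i + j + 1) powr (2 - s) * real (i + j + 1) powr (- 2)"
      by (simp flip: powr_add)
    also have "real (i + j + 1) powr (- 2) = 1 / (real i + 1 + real j)\<^sup>2"
      by (simp add: powr_minus divide_simps add_ac)
    also have "real (i + j + 1) powr (2 - s) * (1 / (real i + 1 + real j)\<^sup>2)
        \<le> real N powr (2 - s) * (1 / (real i + 1 + real j)\<^sup>2)"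
      using assms that by (intro mult_right_mono powr_mono2) auto
    finally show ?thesis .
  qed
  hence "(\<Sum>i<n. \<Sum>j<k. real (i + j + 1) powr (- s))
     \<le> (\<Sum>i<n. \<Sum>j<k. real N powr (2 - s) * (1 / (real i + 1 + real j)\<^sup>2))"
    by (intro sum_mono) auto
  also have "\<dots> = real N powr (2 - s) * (\<Sum>i<n. \<Sum>j<k. 1 / (real i + 1 + real j)\<^sup>2)"
    by (simp only: sum_distrib_left)
  also have "\<dots> \<le> real N powr (2 - s) * (\<Sum>i<n. 2 * (1 / (real i + 1)))"
    using sum_inverse_squares_le[of "real i + 1" k for i] by (intro mult_left_mono sum_mono) auto
  also have "\<dots> = real N powr (2 - s) * (2 * (\<Sum>i<n. 1 / (real i + 1)))"
    by (simp only: sum_distrib_left)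
  also have "\<dots> \<le> real N powr (2 - s) * (2 * (1 + ln (real N)))"
  proof -
    have "(\<Sum>i<n. 1 / (real i + 1)) \<le> 1 + ln (real n)"
      by (rule sum_inverse_le_ln) fact
    also have "\<dots> \<le> 1 + ln (real N)" using assms by simp
    finally show ?thesis by (intro mult_left_mono) auto
  qed
  finally show ?thesis by (simp only: mult_ac)
qed

lemma edge_prob_bounds:
  assumes "\<beta> > 0"
  shows "0 \<le> edge_prob s \<beta> N x y" "edge_prob s \<beta> N x y \<le> 1"
  using assms by (auto simp: edge_prob_def)

text \<open>The cycle distance is the length of one of the two ways around the cycle, so its power
  is at most the sum of both powers, and no case distinction on the minimum remains. The factor
  \<open>max 1 \<beta>\<close>, in place of \<beta>, also covers the certain edges at distance
  1.\<close>

lemma edge_prob_le: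
  assumes "(x, y) \<in> vertex_pairs N" "\<beta> > 0"
  shows "edge_prob s \<beta> N x y
           \<le> max 1 \<beta> * (real (y - x) powr (- s) + real (N - y + x) powr (- s))"
proof -
  define r where "r = real_of_int (cycle_dist N x y)"
  \<comment> \<open>This is 1 + u \<le> exp u at u =
    \<open>- \<beta> * r powr (- s)\<close>.\<close>
  have "1 - exp (- \<beta> * r powr (- s)) \<le> \<beta> * r powr (- s)"
    using exp_ge_add_one_self[of "- \<beta> * r powr (- s)"] by simp
  also have "\<dots> \<le> max 1 \<beta> * r powr (- s)"
    by (intro mult_right_mono) auto
  finally have "edge_prob s \<beta> N x y \<le> max 1 \<beta> * r powr (- s)"
    by (auto simp: edge_prob_def r_def)
  also have "r = real (y - x) \<or> r = real (N - y + x)"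
    using assms(1) by (auto simp: r_def cycle_dist_def vertex_pairs_def min_def of_nat_diff)
  hence "r powr (- s) \<le> real (y - x) powr (- s) + real (N - y + x) powr (- s)"
    by auto
  finally show ?thesis by (simp add: mult_left_mono)
qed

text \<open>The two arcs meet in two places, between \<open>m - 1\<close> and \<open>m\<close> and
  between \<open>N - 1\<close> and 0. The two terms of \<open>edge_prob_le\<close> measure distance
  through one of these each. Counting positions in both arcs from the meeting point makes every
  distance i + j + 1, so both terms sum to the same \<open>S\<close>.\<close>

lemma sum_edge_prob_cut_le:
  assumes "\<beta> > 0" "s \<le> 2" "1 \<le> m" "m \<le> N"
  shows "(\<Sum>(x, y)\<in>{..<m} \<times> {m..<N}. edge_prob s \<beta> N x y)
           \<le> 4 * max 1 \<beta> * real N powr (2 - s) * (1 + ln (real N))"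
proof -
  define f where "f = (\<lambda>n. real n powr (- s))"
  define S where "S = (\<Sum>i<m. \<Sum>j<N - m. f (i + j + 1))"
  have shift: "(\<Sum>y\<in>{m..<N}. g y) = (\<Sum>j<N - m. g (m + j))" for g :: "nat \<Rightarrow> real"
    by (rule sum.reindex_bij_witness[of _ "\<lambda>j. m + j" "\<lambda>y. y - m"]) auto
  have "(\<Sum>(x, y)\<in>{..<m} \<times> {m..<N}. edge_prob s \<beta> N x y)
      \<le> (\<Sum>(x, y)\<in>{..<m} \<times> {m..<N}. max 1 \<beta> * (f (y - x) + f (N - y + x)))"
    using assms(1) unfolding f_def
    by (intro sum_mono, clarify, intro edge_prob_le) (auto simp: vertex_pairs_def)
  also have "\<dots> = max 1 \<beta> * ((\<Sum>x<m. \<Sum>j<N - m. f (m + j - x))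
                              + (\<Sum>x<m. \<Sum>j<N - m. f (N - (m + j) + x)))"
    by (simp add: sum.cartesian_product[symmetric] shift sum.distrib flip: sum_distrib_left)
  \<comment> \<open>Here the first arc is reversed: with x = \<open>m - Suc i\<close> the distance
    \<open>m + j - x\<close> becomes i + j + 1.\<close>
  also have "(\<Sum>x<m. \<Sum>j<N - m. f (m + j - x)) = S"
    unfolding S_def
    by (subst sum.nat_diff_reindex[symmetric]) (auto intro!: sum.cong arg_cong[of _ _ f])
  also have "(\<Sum>x<m. \<Sum>j<N - m. f (N - (m + j) + x)) = S"
    unfolding S_def
  proof (rule sum.cong[OF refl])
    fix x assume "x \<in> {..<m}"
    \<comment> \<open>Around the other side it is the second arc that has to be reversed, so the
      index \<open>j\<close> is reflected.\<close>
    have "(\<Sum>j<N - m. f (N - (m + j) + x)) = (\<Sum>j<N - m. f (x + (N - m - Suc j) + 1))"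
      by (auto intro!: sum.cong arg_cong[of _ _ f])
    also have "\<dots> = (\<Sum>j<N - m. f (x + j + 1))"
      by (rule sum.nat_diff_reindex)
    finally show "(\<Sum>j<N - m. f (N - (m + j) + x)) = (\<Sum>j<N - m. f (x + j + 1))" .
  qed
  also have "max 1 \<beta> * (S + S) \<le> max 1 \<beta> * (4 * real N powr (2 - s) * (1 + ln (real N)))"
    using double_sum_powr_le[of s m "N - m" N] assms
    by (intro mult_left_mono) (auto simp: S_def f_def mult_ac)
  finally show ?thesis by (simp add: mult_ac)
qed

text \<open>The reals are only conditionally complete, so comparing the infimum with one of its
  members requires a lower bound for all ratios; 0 serves.\<close>

lemma cheeger_constant_le:
  assumes "A \<subseteq> V" "A \<noteq> {}" "real (card A) \<le> real (card V) / 2"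
  shows "cheeger_constant V E \<le> real (card (edge_boundary V E A)) / real (card A)"
  unfolding cheeger_constant_def using assms
  by (intro cINF_lower bdd_belowI[of _ 0]) auto

text \<open>Of the two ends of a boundary edge, the one in the segment is the smaller, so the edge
  comes from an open pair in \<open>{..<m} \<times> {m..<N}\<close>. Passing to an image cannot
  increase the cardinality.\<close>

lemma card_edge_boundary_initial_segment_le:
  "card (edge_boundary {..<N} {{x, y} | x y. (x, y) \<in> vertex_pairs N \<and> \<omega> (x, y)} {..<m})
     \<le> card {p \<in> {..<m} \<times> {m..<N}. \<omega> p}"
proof (rule surj_card_le)
  show "edge_boundary {..<N} {{x, y} | x y. (x, y) \<in> vertex_pairs N \<and> \<omega> (x, y)} {..<m}
          \<subseteq> (\<lambda>(x, y). {x, y}) ` {p \<in> {..<m} \<times> {m..<N}. \<omega> p}"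
    by (force simp: edge_boundary_def vertex_pairs_def doubleton_eq_iff image_iff)
qed auto

lemma prob_Pi_bernoulli_component:
  assumes "finite A" "p \<in> A" "0 \<le> q p" "q p \<le> 1"
  shows "measure_pmf.prob (Pi_pmf A False (\<lambda>p. bernoulli_pmf (q p))) {\<omega>. \<omega> p} = q p"
proof -
  have "measure_pmf.prob (Pi_pmf A False (\<lambda>p. bernoulli_pmf (q p))) ((\<lambda>\<omega>. \<omega> p) -` {True})
      = measure_pmf.prob (bernoulli_pmf (q p)) {True}"
    using assms by (simp flip: measure_map_pmf add: Pi_pmf_component)
  also have "(\<lambda>\<omega>. \<omega> p) -` {True} = {\<omega>. \<omega> p}" by auto
  finally show ?thesis using assms by (simp add: measure_pmf_single)
qed

text \<open>Markov's inequality for the number of open pairs in \<open>S\<close>, whose expectation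
  is the sum of the marginal probabilities by linearity.\<close>

lemma prob_card_ge_le:
  fixes M :: "('a \<Rightarrow> bool) pmf"
  assumes "finite S" "t > 0"
  shows "measure_pmf.prob M {\<omega>. real (card {p \<in> S. \<omega> p}) \<ge> t}
           \<le> (\<Sum>p\<in>S. measure_pmf.prob M {\<omega>. \<omega> p}) / t"
proof -
  define u where "u = (\<lambda>\<omega> :: 'a \<Rightarrow> bool. \<Sum>p\<in>S. indicator {\<omega>. \<omega> p} \<omega> :: real)"
  have u: "u \<omega> = real (card {p \<in> S. \<omega> p})" for \<omega>
    using assms(1) by (simp add: u_def indicator_def sum.If_cases Int_def)
  have int: "integrable (measure_pmf M) (\<lambda>\<omega>. indicator {\<omega>. \<omega> p} \<omega> :: real)" for p
    by (intro measure_pmf.integrable_const_bound[of _ 1]) auto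
  have "measure_pmf.prob M {\<omega> \<in> space (measure_pmf M). u \<omega> \<ge> t}
      \<le> measure_pmf.expectation M u / t"
    using assms(2) int
    by (intro integral_Markov_inequality_measure[where A = "{}"])
       (auto simp: u_def intro!: sum_nonneg)
  also have "measure_pmf.expectation M u = (\<Sum>p\<in>S. measure_pmf.prob M {\<omega>. \<omega> p})"
    unfolding u_def using int by (subst Bochner_Integration.integral_sum) auto
  finally show ?thesis by (simp add: u)
qed

text \<open>Both claims follow from this bound by a choice of \<open>t\<close>. If the Cheeger
  constant exceeds \<open>t\<close>, then the arc \<open>{..<m}\<close> has more than
  \<open>t * m\<close> boundary edges, and Markov's inequality applies to the open pairs across the
  cut.\<close>

lemma prob_cheeger_constant_gt_le:
  assumes "\<beta> > 0" "s \<le> 2" "N \<ge> 2" "t > 0"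
  shows "measure_pmf.prob (long_range_percolation s \<beta> N) {E. cheeger_constant {..<N} E > t}
           \<le> 12 * max 1 \<beta> * real N powr (1 - s) * (1 + ln (real N)) / t"
proof -
  define m where "m = N div 2"
  \<comment> \<open>\<open>2 * m \<le> N\<close> makes the arc admissible in the infimum.
    \<open>N \<le> 3 * m\<close> allows for rounding, with equality at N = 3, and turns the constant
    4 of the cut estimate into 12.\<close>
  have "m \<ge> 1" "m \<le> N" "N \<le> 3 * m" "2 * m \<le> N"
    using assms(3) unfolding m_def by linarith+
  hence m: "m \<ge> 1" "m \<le> N" "real N \<le> 3 * real m" "real m \<le> real N / 2"
    by linarith+
  define S where "S = {..<m} \<times> {m..<N}"
  have S: "S \<subseteq> vertex_pairs N" by (auto simp: S_def vertex_pairs_def)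
  have fin: "finite (vertex_pairs N)"
    by (rule finite_subset[of _ "{..<N} \<times> {..<N}"]) (auto simp: vertex_pairs_def)
  define P where "P = Pi_pmf (vertex_pairs N) False (\<lambda>p. bernoulli_pmf (case_prod (edge_prob s \<beta> N) p))"
  define G where "G = (\<lambda>\<omega>. {{x, y} | x y. (x, y) \<in> vertex_pairs N \<and> \<omega> (x, y)})"
  have law: "long_range_percolation s \<beta> N = map_pmf G P"
    unfolding long_range_percolation_def G_def P_def by (simp add: case_prod_unfold)
  have "measure_pmf.prob (long_range_percolation s \<beta> N) {E. cheeger_constant {..<N} E > t}
      = measure_pmf.prob P {\<omega>. cheeger_constant {..<N} (G \<omega>) > t}"
    by (simp add: law vimage_def)
  also have "\<dots> \<le> measure_pmf.prob P {\<omega>. real (card {p \<in> S. \<omega> p}) \<ge> t * real m}"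
  proof (intro measure_pmf.finite_measure_mono subsetI CollectI)
    fix \<omega> assume "\<omega> \<in> {\<omega>. cheeger_constant {..<N} (G \<omega>) > t}"
    hence "t < real (card (edge_boundary {..<N} (G \<omega>) {..<m})) / real m"
      using cheeger_constant_le[of "{..<m}" "{..<N}" "G \<omega>"] m by (auto simp: lessThan_empty_iff)
    also have "\<dots> \<le> real (card {p \<in> S. \<omega> p}) / real m"
      using card_edge_boundary_initial_segment_le[of N \<omega> m]
      by (intro divide_right_mono) (auto simp: G_def S_def)
    finally show "real (card {p \<in> S. \<omega> p}) \<ge> t * real m"
      using m by (simp add: field_simps)
  qed auto
  also have "\<dots> \<le> (\<Sum>p\<in>S. measure_pmf.prob P {\<omega>. \<omega> p}) / (t * real m)"
    using assms m by (intro prob_card_ge_le) (auto simp: S_def)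
  also have "(\<Sum>p\<in>S. measure_pmf.prob P {\<omega>. \<omega> p}) = (\<Sum>(x, y)\<in>S. edge_prob s \<beta> N x y)"
    unfolding P_def using S fin assms(1)
    by (intro sum.cong refl, subst prob_Pi_bernoulli_component) (auto simp: edge_prob_bounds)
  also have "\<dots> / (t * real m)
      \<le> (4 * max 1 \<beta> * real N powr (2 - s) * (1 + ln (real N))) / (t * (real N / 3))"
    using sum_edge_prob_cut_le[of \<beta> s m N] assms m
    by (intro frac_le mult_left_mono) (auto simp: S_def)
  also have "\<dots> = 12 * max 1 \<beta> * (real N powr (2 - s) / real N powr 1) * (1 + ln (real N)) / t"
    using assms by (simp add: mult_ac)
  also have "real N powr (2 - s) / real N powr 1 = real N powr (1 - s)"
    by (simp only: flip: powr_diff) simp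
  finally show ?thesis .
qed

theorem theorem5p1:
  "(\<forall>s::real. 1 < s \<and> s < 2 \<longrightarrow>
      (\<exists>\<alpha>::real. \<alpha> > 0 \<and>
        (\<forall>\<beta>::real. \<beta> > 0 \<longrightarrow>
          (\<lambda>N. measure_pmf.prob (long_range_percolation s \<beta> N)
                 {E. cheeger_constant {..<N} E > real N powr (- \<alpha>)}) \<longlonglongrightarrow> 0)))
   \<and>
   (\<forall>\<beta>::real. \<beta> > 0 \<longrightarrow>
      (\<forall>\<epsilon>::real. \<epsilon> > 0 \<longrightarrow>
        (\<exists>C::real.
          limsup (\<lambda>N. ereal (measure_pmf.prob (long_range_percolation 2 \<beta> N)
                 {E. cheeger_constant {..<N} E > C * ln (real N) / real N})) < ereal \<epsilon>)))"
proof (intro conjI allI impI)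
  fix s :: real
  assume s: "1 < s \<and> s < 2"
  \<comment> \<open>With 1 - s = -2 \<alpha>, dividing the bound by the threshold
    \<open>N powr (- \<alpha>)\<close> still leaves a factor \<open>N powr (- \<alpha>)\<close>,
    which beats the logarithm. The parameter \<beta> enters only the constant, so \<alpha> depends
    on \<open>s\<close> alone.\<close>
  define \<alpha> where "\<alpha> = (s - 1) / 2"
  have \<alpha>: "\<alpha> > 0" using s by (simp add: \<alpha>_def)
  show "\<exists>\<alpha>::real. \<alpha> > 0 \<and>
        (\<forall>\<beta>::real. \<beta> > 0 \<longrightarrow>
          (\<lambda>N. measure_pmf.prob (long_range_percolation s \<beta> N)
                 {E. cheeger_constant {..<N} E > real N powr (- \<alpha>)}) \<longlonglongrightarrow> 0)"
  proof (intro exI[of _ \<alpha>] conjI allI impI \<alpha>)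
    fix \<beta> :: real
    assume \<beta>: "\<beta> > 0"
    show "(\<lambda>N. measure_pmf.prob (long_range_percolation s \<beta> N)
             {E. cheeger_constant {..<N} E > real N powr (- \<alpha>)}) \<longlonglongrightarrow> 0"
    proof (rule tendsto_sandwich[OF _ _ tendsto_const])
      have "measure_pmf.prob (long_range_percolation s \<beta> N)
             {E. cheeger_constant {..<N} E > real N powr (- \<alpha>)}
           \<le> 12 * max 1 \<beta> * (real N powr (- \<alpha>) * (1 + ln (real N)))" if "N \<ge> 2" for N
      proof -
        have "measure_pmf.prob (long_range_percolation s \<beta> N)
               {E. cheeger_constant {..<N} E > real N powr (- \<alpha>)}
            \<le> 12 * max 1 \<beta> * real N powr (1 - s) * (1 + ln (real N)) / real N powr (- \<alpha>)"
          using \<beta> s that by (intro prob_cheeger_constant_gt_le) auto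
        also have "\<dots> = 12 * max 1 \<beta> * (real N powr (1 - s) / real N powr (- \<alpha>) * (1 + ln (real N)))"
          by simp
        also have "real N powr (1 - s) / real N powr (- \<alpha>) = real N powr (- \<alpha>)"
          by (simp add: \<alpha>_def diff_divide_distrib flip: powr_diff)
        finally show ?thesis .
      qed
      thus "\<forall>\<^sub>F N in sequentially. measure_pmf.prob (long_range_percolation s \<beta> N)
             {E. cheeger_constant {..<N} E > real N powr (- \<alpha>)}
           \<le> 12 * max 1 \<beta> * (real N powr (- \<alpha>) * (1 + ln (real N)))"
        by (auto simp: eventually_sequentially)
      have "(\<lambda>N. real N powr (- \<alpha>) * (1 + ln (real N))) \<longlonglongrightarrow> 0"
        using \<alpha> by real_asymp
      thus "(\<lambda>N. 12 * max 1 \<beta> * (real N powr (- \<alpha>) * (1 + ln (real N)))) \<longlonglongrightarrow> 0"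
        by (rule tendsto_mult_right_zero)
    qed auto
  qed
next
  fix \<beta> \<epsilon> :: real
  assume \<beta>: "\<beta> > 0" and \<epsilon>: "\<epsilon> > 0"
  define K where "K = 12 * max 1 \<beta>"
  have K: "K > 0" by (simp add: K_def)
  \<comment> \<open>The probability will be at most 2 K / C, which this choice makes \<epsilon> / 2;
    the other half of \<epsilon> keeps the inequality strict after passing to the limsup.\<close>
  define C where "C = 4 * K / \<epsilon>"
  have C: "C > 0" using K \<epsilon> by (simp add: C_def)
  have "measure_pmf.prob (long_range_percolation 2 \<beta> N)
          {E. cheeger_constant {..<N} E > C * ln (real N) / real N} \<le> \<epsilon> / 2" if N: "N \<ge> 3" for N
  proof -
    \<comment> \<open>For N \<ge> 3 > e the logarithm is at least 1. Hence the threshold is positive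
      and 1 + ln N \<le> 2 ln N.\<close>
    have "exp 1 \<le> real N" using exp_le N by linarith
    hence ln: "ln (real N) \<ge> 1" using N by (subst ln_ge_iff) auto
    have "measure_pmf.prob (long_range_percolation 2 \<beta> N)
            {E. cheeger_constant {..<N} E > C * ln (real N) / real N}
        \<le> K * real N powr (1 - 2) * (1 + ln (real N)) / (C * ln (real N) / real N)"
      unfolding K_def using \<beta> N C ln by (intro prob_cheeger_constant_gt_le) auto
    also have "\<dots> = K * (1 + ln (real N)) / (C * ln (real N))"
      using N by (simp add: powr_minus_divide)
    also have "\<dots> \<le> K * (2 * ln (real N)) / (C * ln (real N))"
      using K C ln by (intro divide_right_mono mult_left_mono) auto
    also have "\<dots> = \<epsilon> / 2"
      using K \<epsilon> ln by (simp add: C_def)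
    finally show ?thesis .
  qed
  hence "\<forall>\<^sub>F N in sequentially. ereal (measure_pmf.prob (long_range_percolation 2 \<beta> N)
          {E. cheeger_constant {..<N} E > C * ln (real N) / real N}) \<le> ereal (\<epsilon> / 2)"
    by (auto simp: eventually_sequentially)
  hence "limsup (\<lambda>N. ereal (measure_pmf.prob (long_range_percolation 2 \<beta> N)
          {E. cheeger_constant {..<N} E > C * ln (real N) / real N})) \<le> ereal (\<epsilon> / 2)"
    by (rule Limsup_bounded)
  also have "\<dots> < ereal \<epsilon>" using \<epsilon> by simp
  finally show "\<exists>C::real.
          limsup (\<lambda>N. ereal (measure_pmf.prob (long_range_percolation 2 \<beta> N)
                 {E. cheeger_constant {..<N} E > C * ln (real N) / real N})) < ereal \<epsilon>"
    by blast
qed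

end
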